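(* Let $p$ be an odd prime. For $d\in\mathbb{Z}$ define $$S(d,p):=\det\left[\left(\frac{i^2+dj^2}{p}\right)\right]_{1\leqslant i,j\leqslant (p-1)/2},\qquad T(d,p):=\det\left[\left(\frac{i^2+dj^2}{p}\right)\right]_{0\leqslant i,j\leqslant (p-1)/2}.$$ Then: (i) For all $d\in\mathbb{Z}$ and all $c\in\mathbb{Z}$ with $p\nmid c$, $$S(c^2d,p)=\left(\frac cp\right)^{(p+1)/2}S(d,p)\quad\text{and}\quad T(c^2d,p)=\left(\frac cp\right)^{(p+1)/2}T(d,p).$$ If $p\equiv 1\pmod 4$, then for all $d\in\mathbb{Z}$, $S(-d,p)=\left(\frac 2p\right)S(d,p)$ and $T(-d,p)=\left(\frac 2p\right)T(d,p)$. If $p\equiv 3\pmod 4$, then $S(d,p)=0$ for every $d\in\mathbb{Z}$ with $\left(\frac dp\right)=-1$. (ii) For $d\in\mathbb{Z}$, $$\left(\frac{T(d,p)}{p}\right)=\left(\frac 2p\right)\ \text{ if }\left(\frac dp\right)=1,\qquad \left(\frac{T(d,p)}{p}\right)=1\ \text{ if }\left(\frac dp\right)=-1.$$ Also, for all $d\in\mathbb{Z}$, $T(-d,p)\equiv\left(\frac 2p\right)T(d,p)\pmod p$, and for all $c,d\in\mathbb{Z}$, $$\det\left[\left(\frac{i^2+dj^2+c}{p}\right)\right]_{0\leqslant i,j\leqslant (p-1)/2}\equiv T(d,p)\pmod p.$$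
   Context: $\left(\frac{\cdot}{p}\right)$ denotes the Legendre symbol modulo $p$ (with $\left(\frac{a}{p}\right)=0$ when $p\mid a$). $\det[a_{ij}]_{r\leqslant i,j\leqslant n}$ denotes the determinant of the matrix with rows and columns indexed by $r,\dots,n$. *)

theory Defs
  imports "HOL-Number_Theory.Number_Theory" "Jordan_Normal_Form.Determinant"
begin

text \<open>Matrices are indexed from \<open>0\<close>, so the entry of \<open>S_det\<close> at \<open>(i, j)\<close> uses the indices
  \<open>i + 1\<close> and \<open>j + 1\<close>.\<close>

definition S_det :: "int \<Rightarrow> nat \<Rightarrow> int" where
  "S_det d p = det (mat ((p - 1) div 2) ((p - 1) div 2)
     (\<lambda>(i, j). Legendre ((int i + 1)\<^sup>2 + d * (int j + 1)\<^sup>2) (int p)))"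

definition T_det :: "int \<Rightarrow> nat \<Rightarrow> int" where
  "T_det d p = det (mat ((p - 1) div 2 + 1) ((p - 1) div 2 + 1)
     (\<lambda>(i, j). Legendre ((int i)\<^sup>2 + d * (int j)\<^sup>2) (int p)))"

end

theory Submission
  imports Defs
begin

text \<open>Let \<open>n = (p - 1) / 2\<close>. Replacing \<open>d\<close> by \<open>c\<^sup>2 d\<close> permutes the columns by \<open>j \<mapsto> \<plusminus>c j\<close>; the sign of
  this permutation is read off modulo \<open>p\<close> from the Vandermonde determinant \<open>V\<close> of the squares.
  By Euler's criterion the entries of \<open>T(d, p)\<close> are \<open>(i\<^sup>2 + d j\<^sup>2)\<^sup>n\<close> modulo \<open>p\<close>, and the binomial theorem
  factors this matrix into Vandermonde matrices, giving
  \<open>T(d, p) \<equiv> (-1)\<^sup>m (\<Prod>k\<le>n. n choose k) d\<^sup>m V\<^sup>2\<close> with \<open>m = n (n + 1) / 2\<close>. Adding \<open>c\<close> shifts the points of one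
  factor, which does not change its determinant. Finally \<open>(2/p) = (-1)\<^sup>m\<close>, and the product of the
  binomial coefficients is \<open>(n!)\<^sup>n\<^sup>+\<^sup>1\<close> up to a square, where \<open>(n!)\<^sup>2 \<equiv> -1\<close> for even \<open>n\<close>.\<close>

section \<open>Vandermonde determinants\<close>

lemma det_mat_Leibniz:
  "det (mat n n f) = (\<Sum>\<sigma> | \<sigma> permutes {0..<n}. signof \<sigma> * (\<Prod>i=0..<n. f (i, \<sigma> i)))"
proof -
  have "(\<Prod>i=0..<n. mat n n f $$ (i, \<sigma> i)) = (\<Prod>i=0..<n. f (i, \<sigma> i))"
    if "\<sigma> permutes {0..<n}" for \<sigma>
    using permutes_in_image[OF that] by (intro prod.cong) auto
  then show ?thesis
    by (subst det_def'[of _ n]) (auto intro!: sum.cong)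
qed

lemma det_scale_rows_columns:
  fixes a :: "nat \<Rightarrow> nat \<Rightarrow> 'a::comm_ring_1"
  shows "det (mat n n (\<lambda>(i, j). r i * c j * a i j))
       = (\<Prod>i=0..<n. r i) * (\<Prod>j=0..<n. c j) * det (mat n n (\<lambda>(i, j). a i j))"
proof -
  have "(\<Prod>i=0..<n. r i * c (\<sigma> i) * a i (\<sigma> i))
      = (\<Prod>i=0..<n. r i) * (\<Prod>j=0..<n. c j) * (\<Prod>i=0..<n. a i (\<sigma> i))"
    if "\<sigma> permutes {0..<n}" for \<sigma>
    using prod.permute[OF that, of c] by (simp add: prod.distrib o_def)
  then show ?thesis
    unfolding det_mat_Leibniz sum_distrib_left
    by (intro sum.cong) (auto simp: mult_ac)
qed

lemma det_permute_columns:
  fixes f :: "nat \<times> nat \<Rightarrow> 'a::comm_ring_1"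
  assumes "\<sigma> permutes {0..<n}"
  shows "det (mat n n (\<lambda>(i, j). f (i, \<sigma> j))) = signof \<sigma> * det (mat n n f)"
proof -
  have lt: "\<sigma> j < n" if "j < n" for j
    using permutes_in_image[OF assms, of j] that by simp
  have "transpose_mat (mat n n (\<lambda>(i, j). f (i, \<sigma> j)))
      = mat n n (\<lambda>(i, j). transpose_mat (mat n n f) $$ (\<sigma> i, j))"
    by (rule eq_matI) (auto simp: lt)
  then have "det (transpose_mat (mat n n (\<lambda>(i, j). f (i, \<sigma> j)))) = signof \<sigma> * det (transpose_mat (mat n n f))"
    using det_permute_rows[OF _ assms, of "transpose_mat (mat n n f)"] by simp
  then show ?thesis
    using det_transpose[of "mat n n (\<lambda>(i, j). f (i, \<sigma> j))" n] det_transpose[of "mat n n f" n] by simp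
qed

lemma det_cong_mod:
  fixes f g :: "nat \<Rightarrow> nat \<Rightarrow> int"
  assumes "\<And>i j. i < n \<Longrightarrow> j < n \<Longrightarrow> [f i j = g i j] (mod m)"
  shows "[det (mat n n (\<lambda>(i, j). f i j)) = det (mat n n (\<lambda>(i, j). g i j))] (mod m)"
  unfolding det_mat_Leibniz
proof (rule cong_sum, rule cong_scalar_left)
  fix \<sigma> assume "\<sigma> \<in> {\<sigma>. \<sigma> permutes {0..<n}}"
  then have "\<sigma> i < n" if "i < n" for i
    using permutes_in_image[of \<sigma> "{0..<n}" i] that by simp
  then show "[(\<Prod>i=0..<n. case (i, \<sigma> i) of (i, j) \<Rightarrow> f i j) = (\<Prod>i=0..<n. case (i, \<sigma> i) of (i, j) \<Rightarrow> g i j)] (mod m)"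
    by (auto intro!: cong_prod assms)
qed

section \<open>Vandermonde determinants under changes of basis, affine maps and permutations\<close>

definition vandermonde :: "nat \<Rightarrow> (nat \<Rightarrow> 'a) \<Rightarrow> 'a::comm_ring_1" where
  "vandermonde n x = det (mat n n (\<lambda>(i, j). x i ^ j))"

text \<open>Passing from monomials to the \<open>q j\<close> multiplies by the coefficient matrix
  \<open>U\<close>, which is upper triangular with unit diagonal because \<open>q j\<close> is monic
  of degree \<open>j\<close>.\<close>

lemma det_monic_polys:
  fixes x :: "nat \<Rightarrow> 'a::comm_ring_1"
  assumes deg: "\<And>j. degree (q j) = j" and monic: "\<And>j. lead_coeff (q j) = 1"
  shows "det (mat n n (\<lambda>(i, j). poly (q j) (x i))) = vandermonde n x"
proof -
  define V where "V = mat n n (\<lambda>(i, j). x i ^ j)"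
  define U where "U = mat n n (\<lambda>(i, j). coeff (q j) i)"
  have "mat n n (\<lambda>(i, j). poly (q j) (x i)) = V * U"
  proof (rule eq_matI)
    fix i j assume "i < dim_row (V * U)" "j < dim_col (V * U)"
    then have ij: "i < n" "j < n" by (auto simp: V_def U_def)
    have "poly (q j) (x i) = (\<Sum>k\<le>j. coeff (q j) k * x i ^ k)"
      by (simp add: poly_altdef deg)
    also have "\<dots> = (\<Sum>k=0..<n. coeff (q j) k * x i ^ k)"
      using ij by (intro sum.mono_neutral_left) (auto simp: coeff_eq_0 deg)
    finally show "mat n n (\<lambda>(i, j). poly (q j) (x i)) $$ (i, j) = (V * U) $$ (i, j)"
      using ij by (simp add: V_def U_def scalar_prod_def mult.commute)
  qed (auto simp: V_def U_def)
  moreover have "det U = 1"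
  proof -
    have "det U = prod_list (diag_mat U)"
      by (rule det_upper_triangular[of _ n])
        (auto simp: U_def deg intro!: upper_triangularI coeff_eq_0)
    also have "\<dots> = (\<Prod>i=0..<n. coeff (q i) i)"
      by (simp add: prod_list_diag_prod U_def)
    also have "\<dots> = 1"
      using monic by (simp add: deg)
    finally show ?thesis .
  qed
  ultimately show ?thesis
    using det_mult[of V n U] by (simp add: V_def U_def vandermonde_def)
qed

text \<open>Newton's basis \<open>\<Prod>l<j. (X - x l)\<close> makes the matrix triangular.\<close>

lemma vandermonde_prod:
  fixes x :: "nat \<Rightarrow> 'a::idom"
  shows "vandermonde n x = (\<Prod>j=0..<n. \<Prod>l<j. x j - x l)"
proof -
  define q where "q j = (\<Prod>l<j. [:- x l, 1:])" for j
  have "degree (q j) = j" for j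
    by (simp add: q_def degree_prod_eq_sum_degree)
  moreover have "lead_coeff (q j) = 1" for j
    by (simp add: q_def lead_coeff_prod)
  ultimately have "vandermonde n x = det (mat n n (\<lambda>(i, j). poly (q j) (x i)))"
    by (rule det_monic_polys[symmetric])
  also have "\<dots> = prod_list (diag_mat (mat n n (\<lambda>(i, j). poly (q j) (x i))))"
    by (rule det_lower_triangular[of n]) (auto simp: q_def poly_prod)
  also have "\<dots> = (\<Prod>j=0..<n. \<Prod>l<j. x j - x l)"
    by (simp add: prod_list_diag_prod q_def poly_prod)
  finally show ?thesis .
qed

lemma vandermonde_shift:
  fixes x :: "nat \<Rightarrow> 'a::idom"
  shows "vandermonde n (\<lambda>i. x i + c) = vandermonde n x"
  by (simp add: vandermonde_prod)

lemma vandermonde_scale: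
  "vandermonde n (\<lambda>i. a * x i) = a ^ (n * (n - 1) div 2) * vandermonde n x"
proof -
  have "(\<Prod>j=0..<n. a ^ j) = a ^ (n * (n - 1) div 2)"
    by (simp flip: power_sum add: Sum_Ico_nat)
  then show ?thesis
    using det_scale_rows_columns[of n "\<lambda>_. 1" "\<lambda>j. a ^ j" "\<lambda>i j. x i ^ j"]
    by (simp add: vandermonde_def power_mult_distrib)
qed

lemma vandermonde_permute:
  assumes "\<sigma> permutes {0..<n}"
  shows "vandermonde n (x \<circ> \<sigma>) = signof \<sigma> * vandermonde n x"
proof -
  have "\<sigma> i < n" if "i < n" for i
    using permutes_in_image[OF assms, of i] that by simp
  then have "mat n n (\<lambda>(i, j). (x \<circ> \<sigma>) i ^ j)
      = mat n n (\<lambda>(i, j). mat n n (\<lambda>(i, j). x i ^ j) $$ (\<sigma> i, j))"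
    by (intro eq_matI) auto
  then show ?thesis
    using det_permute_rows[OF _ assms, of "mat n n (\<lambda>(i, j). x i ^ j)"]
    by (simp add: vandermonde_def)
qed

text \<open>Reversal acts on the points \<open>0, \<dots>, n - 1\<close> as \<open>x \<mapsto> (n - 1) - x\<close>, so its sign can be read off
  the behaviour of the Vandermonde determinant under affine maps.\<close>

lemma signof_reverse:
  fixes n :: nat
  defines "\<rho> \<equiv> \<lambda>i. if i < n then n - 1 - i else i"
  shows "\<rho> permutes {0..<n}" and "signof \<rho> = (-1 :: int) ^ (n * (n - 1) div 2)"
proof -
  show perm: "\<rho> permutes {0..<n}"
    by (rule bij_imp_permutes, rule bij_betw_byWitness[of _ \<rho>]) (auto simp: \<rho>_def)
  have "signof \<rho> * vandermonde n int = vandermonde n (int \<circ> \<rho>)"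
    by (simp add: vandermonde_permute[OF perm])
  also have "\<dots> = vandermonde n (\<lambda>i. (-1) * int i + (int n - 1))"
    unfolding vandermonde_def
    by (rule arg_cong[of _ _ det], rule eq_matI) (auto simp: \<rho>_def of_nat_diff algebra_simps)
  also have "\<dots> = (-1) ^ (n * (n - 1) div 2) * vandermonde n int"
    by (simp only: vandermonde_shift vandermonde_scale)
  \<comment> \<open>The points are distinct integers, so \<open>vandermonde n int\<close> is nonzero
    and cancels.\<close>
  finally show "signof \<rho> = (-1 :: int) ^ (n * (n - 1) div 2)"
    by (auto simp: vandermonde_prod)
qed

text \<open>The binomial theorem factors the matrix as \<open>A * B\<close>. Up to the row factors
  \<open>n choose k\<close>, \<open>B\<close> is a transposed Vandermonde matrix with descending
  exponents; restoring their order costs the sign of the reversal.\<close>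

lemma det_power_sum:
  fixes x y :: "nat \<Rightarrow> int"
  shows "det (mat (Suc n) (Suc n) (\<lambda>(i, j). (x i + y j) ^ n))
       = (-1) ^ (n * (n + 1) div 2) * (\<Prod>k\<le>n. int (n choose k))
         * vandermonde (Suc n) x * vandermonde (Suc n) y"
proof -
  define A where "A = mat (Suc n) (Suc n) (\<lambda>(i, k). x i ^ k)"
  \<comment> \<open>The factor \<open>1\<close> is the trivial column scaling in the pattern of
    \<open>det_scale_rows_columns\<close>.\<close>
  define B where "B = mat (Suc n) (Suc n) (\<lambda>(k, j). int (n choose k) * 1 * y j ^ (n - k))"
  define R where "R = mat (Suc n) (Suc n) (\<lambda>(j, k). y j ^ (n - k))"
  define \<rho> where "\<rho> i = (if i < Suc n then Suc n - 1 - i else i)" for i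
  have "mat (Suc n) (Suc n) (\<lambda>(i, j). (x i + y j) ^ n) = A * B"
    by (rule eq_matI)
      (auto simp: A_def B_def scalar_prod_def binomial_ring lessThan_Suc_atMost atLeast0LessThan mult_ac
        intro!: sum.cong)
  moreover have "det B = (\<Prod>k\<le>n. int (n choose k)) * det (transpose_mat R)"
  proof -
    have "transpose_mat R = mat (Suc n) (Suc n) (\<lambda>(k, j). y j ^ (n - k))"
      by (rule eq_matI) (auto simp: R_def)
    then show ?thesis
      unfolding B_def det_scale_rows_columns by (simp add: lessThan_Suc_atMost atLeast0LessThan)
  qed
  moreover have "det R = (-1) ^ (n * (n + 1) div 2) * vandermonde (Suc n) y"
  proof -
    have "R = mat (Suc n) (Suc n) (\<lambda>(i, j). (\<lambda>(i, j). y i ^ j) (i, \<rho> j))"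
      by (rule eq_matI) (auto simp: R_def \<rho>_def)
    then show ?thesis
      using det_permute_columns[OF signof_reverse(1)[of "Suc n"], of "\<lambda>(i, j). y i ^ j"]
        signof_reverse(2)[of "Suc n"]
      by (simp add: \<rho>_def[abs_def] vandermonde_def mult.commute)
  qed
  moreover have "A \<in> carrier_mat (Suc n) (Suc n)" "B \<in> carrier_mat (Suc n) (Suc n)"
    "R \<in> carrier_mat (Suc n) (Suc n)"
    by (auto simp: A_def B_def R_def)
  ultimately show ?thesis
    using det_mult[of A "Suc n" B] det_transpose[of R "Suc n"]
    by (simp add: vandermonde_def A_def mult_ac)
qed

section \<open>Legendre symbols and half residues\<close>

lemma Legendre_cong:
  assumes "[a = b] (mod p)"
  shows "Legendre a p = Legendre b p"
proof -
  have "[a = 0] (mod p) \<longleftrightarrow> [b = 0] (mod p)"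
    using assms cong_sym cong_trans by blast
  moreover have "QuadRes p a \<longleftrightarrow> QuadRes p b"
    unfolding QuadRes_def using assms cong_sym cong_trans by blast
  ultimately show ?thesis
    by (simp add: Legendre_def)
qed

lemma Legendre_values: "Legendre a p \<in> {- 1, 0, 1}"
  by (simp add: Legendre_def)

lemma Legendre_eq_0_iff: "Legendre a p = 0 \<longleftrightarrow> p dvd a"
  by (auto simp: Legendre_def cong_0_iff)

text \<open>Such values differ by at most 2, which is below \<open>p\<close>. This turns congruences
  between signs or Legendre symbols into equalities.\<close>

lemma cong_imp_eq_of_small:
  fixes a b :: int
  assumes "[a = b] (mod int p)" "p > 2" "a \<in> {- 1, 0, 1}" "b \<in> {- 1, 0, 1}"
  shows "a = b"
proof -
  have "int p dvd a - b"
    using assms(1) by (simp add: cong_iff_dvd_diff)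
  moreover have "\<bar>a - b\<bar> < int p"
    using assms(2-) by auto
  ultimately show ?thesis
    using dvd_imp_le_int[of "a - b" "int p"] by force
qed

lemma cong_square_imp:
  fixes a b :: int
  assumes "prime p" and "[a\<^sup>2 = b\<^sup>2] (mod p)"
  shows "[a = b] (mod p) \<or> [a = - b] (mod p)"
proof -
  have "p dvd (a - b) * (a + b)"
    using assms(2) by (simp add: cong_iff_dvd_diff power2_eq_square algebra_simps)
  then show ?thesis
    using assms(1) by (auto simp: prime_dvd_mult_iff cong_iff_dvd_diff)
qed

text \<open>Multiply \<open>(m choose k) * k! * (m - k)! = m!\<close> over all \<open>k\<close>; the
  reflection of \<open>k\<close> to \<open>m - k\<close> identifies the two factorial
  products.\<close>

lemma prod_binomial_fact:
  "(\<Prod>k\<le>m. int (m choose k)) * (\<Prod>k\<le>m. fact k)\<^sup>2 = fact m ^ (m + 1)"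
proof -
  have "(\<Prod>k\<le>m. fact (m - k) :: int) = (\<Prod>k\<le>m. fact k)"
    by (rule prod.reindex_bij_witness[of _ "\<lambda>k. m - k" "\<lambda>k. m - k"]) auto
  then have "(\<Prod>k\<le>m. int (m choose k)) * (\<Prod>k\<le>m. fact k)\<^sup>2
      = (\<Prod>k\<le>m. int (m choose k) * (fact k * fact (m - k)))"
    by (simp add: prod.distrib power2_eq_square)
  also have "\<dots> = (\<Prod>k\<le>m. fact m)"
  proof (rule prod.cong[OF refl])
    fix k assume "k \<in> {..m}"
    then have "int (fact k * fact (m - k) * (m choose k)) = int (fact m)"
      by (simp only: binomial_fact_lemma atMost_iff)
    then show "int (m choose k) * (fact k * fact (m - k)) = fact m"
      by (simp add: mult_ac)
  qed
  finally show ?thesis by simp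
qed

locale odd_prime =
  fixes p n :: nat
  assumes prime: "prime p" and p_eq: "p = 2 * n + 1"
begin

lemma n_pos: "n > 0"
  using prime p_eq by (cases n) auto

lemma p_gt_2: "p > 2"
  using n_pos p_eq by simp

lemma prime_int: "prime (int p)"
  using prime by simp

lemma coprime_p: "\<not> int p dvd a \<Longrightarrow> coprime a (int p)"
  using prime_imp_coprime[OF prime_int] by (simp add: coprime_commute)

section \<open>Euler's criterion and multiplicativity\<close>

lemma Legendre_cong_power: "[Legendre a (int p) = a ^ n] (mod int p)"
  using euler_criterion[OF prime p_gt_2, of a] by (simp add: p_eq)

lemma Legendre_unique:
  assumes "[a ^ n = s] (mod int p)" "s \<in> {- 1, 0, 1}"
  shows "Legendre a (int p) = s"
  using cong_imp_eq_of_small[OF cong_trans[OF Legendre_cong_power assms(1)] p_gt_2 Legendre_values assms(2)] .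

lemma Legendre_mult: "Legendre (a * b) (int p) = Legendre a (int p) * Legendre b (int p)"
proof (rule Legendre_unique)
  show "[(a * b) ^ n = Legendre a (int p) * Legendre b (int p)] (mod int p)"
    unfolding power_mult_distrib by (intro cong_mult cong_sym[OF Legendre_cong_power])
  show "Legendre a (int p) * Legendre b (int p) \<in> {- 1, 0, 1}"
    using Legendre_values[of a "int p"] Legendre_values[of b "int p"] by auto
qed

lemma Legendre_1: "Legendre 1 (int p) = 1"
  by (rule Legendre_unique) auto

lemma Legendre_minus_1: "Legendre (- 1) (int p) = (- 1) ^ n"
  by (rule Legendre_unique) (auto simp: minus_one_power_iff)

lemma Legendre_power: "Legendre (a ^ k) (int p) = Legendre a (int p) ^ k"
  by (induction k) (simp_all add: Legendre_1 Legendre_mult)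

lemma Legendre_square:
  assumes "\<not> int p dvd a"
  shows "Legendre (a\<^sup>2) (int p) = 1"
  using assms Legendre_values[of a "int p"] Legendre_eq_0_iff[of a "int p"]
  by (auto simp: Legendre_power)

lemma fact_coprime: "m \<le> n \<Longrightarrow> \<not> int p dvd fact m"
  using prime_dvd_fact_iff[OF prime, of m] int_dvd_int_iff[of p "fact m"] p_eq by simp

section \<open>The numbers \<open>0, ..., n\<close> as representatives of residues up to
  sign\<close>

lemma exists_half_residue: "\<exists>y\<le>n. [(int y)\<^sup>2 = a\<^sup>2] (mod int p)"
proof -
  define r where "r = nat (a mod int p)"
  have r: "int r = a mod int p" "r < p"
    using p_gt_2 nat_less_iff[of "a mod int p" p] by (auto simp: r_def)
  have ra: "[int r = a] (mod int p)"
    by (simp add: r)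
  show ?thesis
  proof (cases "r \<le> n")
    case True
    then show ?thesis using cong_pow[OF ra, of 2] by blast
  next
    case False
    have "[int (p - r) = - a] (mod int p)"
      using cong_diff[OF cong_refl[of "int p"] ra] r(2) by (simp add: cong_def of_nat_diff)
    from cong_pow[OF this, of 2] have "[(int (p - r))\<^sup>2 = a\<^sup>2] (mod int p)" by simp
    moreover have "p - r \<le> n" using False p_eq by simp
    ultimately show ?thesis by blast
  qed
qed

lemma half_residue_unique:
  assumes "x \<le> n" "y \<le> n" "[(int x)\<^sup>2 = (int y)\<^sup>2] (mod int p)"
  shows "x = y"
proof -
  have "int p dvd int x - int y \<or> int p dvd int x + int y"
    using cong_square_imp[OF prime_int assms(3)] by (auto simp: cong_iff_dvd_diff)
  moreover have "\<bar>int x - int y\<bar> < int p" "\<bar>int x + int y\<bar> < int p"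
    using assms p_eq by auto
  ultimately have "int x - int y = 0 \<or> int x + int y = 0"
    using dvd_imp_le_int[of "int x - int y" "int p"] dvd_imp_le_int[of "int x + int y" "int p"] by fastforce
  then show ?thesis by auto
qed

text \<open>The factors are differences of squares of distinct half residues, since the bound on
  \<open>N\<close> keeps all points \<open>i + a\<close> at most \<open>n\<close>. Hence this
  determinant can be cancelled modulo \<open>p\<close>.\<close>

lemma vandermonde_squares_coprime:
  assumes "N + a \<le> n + 1"
  shows "\<not> int p dvd vandermonde N (\<lambda>i. (int (i + a))\<^sup>2)"
proof
  assume "int p dvd vandermonde N (\<lambda>i. (int (i + a))\<^sup>2)"
  then obtain j l where "j < N" "l < j" "int p dvd (int (j + a))\<^sup>2 - (int (l + a))\<^sup>2"
    using prime_int by (auto simp: vandermonde_prod prime_dvd_prod_iff)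
  moreover from this have "j + a = l + a"
    using assms by (intro half_residue_unique) (auto simp: cong_iff_dvd_diff)
  ultimately show False by simp
qed

text \<open>Multiplication by \<open>c\<close> on \<open>(\<int>/p)\<^sup>\<times>/{\<plusminus>1}\<close>. Its sign is found by applying it to the Vandermonde
  matrix of the squares, where it amounts to a scaling by \<open>c\<^sup>2\<close>.\<close>

lemma multiplication_permutation:
  assumes c: "\<not> int p dvd c" and a: "a \<le> 1"
  defines "N \<equiv> n + 1 - a"
  obtains \<sigma> where "\<sigma> permutes {0..<N}"
    and "\<And>i. i < N \<Longrightarrow> [(int (\<sigma> i + a))\<^sup>2 = c\<^sup>2 * (int (i + a))\<^sup>2] (mod int p)"
    and "signof \<sigma> = Legendre c (int p) ^ (n + 1)"
proof -
  have "\<exists>m<N. [(int (m + a))\<^sup>2 = c\<^sup>2 * (int (i + a))\<^sup>2] (mod int p)" if i: "i < N" for i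
  proof -
    obtain y where y: "y \<le> n" "[(int y)\<^sup>2 = (c * int (i + a))\<^sup>2] (mod int p)"
      using exists_half_residue by blast
    \<comment> \<open>For \<open>a = 1\<close> the representative must be nonzero; otherwise
      \<open>p\<close> would divide \<open>c\<close> or \<open>i + 1\<close>.\<close>
    have "a \<le> y"
    proof (rule ccontr)
      assume "\<not> a \<le> y"
      with a have "a = 1" "y = 0" by auto
      with cong_sym[OF y(2)] have "int p dvd (c * int (i + 1))\<^sup>2"
        by (simp add: cong_0_iff)
      then have "int p dvd int (i + 1)"
        using c prime_int by (auto simp: prime_dvd_power_iff prime_dvd_mult_iff)
      then show False
        using i \<open>a = 1\<close> p_eq by (auto simp: N_def zdvd_not_zless)
    qed
    with y show ?thesis
      by (intro exI[of _ "y - a"]) (use a in \<open>auto simp: N_def power_mult_distrib\<close>)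
  qed
  then obtain \<tau> where \<tau>: "\<And>i. i < N \<Longrightarrow> \<tau> i < N"
      "\<And>i. i < N \<Longrightarrow> [(int (\<tau> i + a))\<^sup>2 = c\<^sup>2 * (int (i + a))\<^sup>2] (mod int p)"
    by metis
  have "inj_on \<tau> {0..<N}"
  proof (rule inj_onI)
    fix i j assume ij: "i \<in> {0..<N}" "j \<in> {0..<N}" "\<tau> i = \<tau> j"
    then have "[c\<^sup>2 * (int (i + a))\<^sup>2 = c\<^sup>2 * (int (j + a))\<^sup>2] (mod int p)"
      using \<tau>(2)[of i] \<tau>(2)[of j] cong_sym cong_trans by (metis atLeastLessThan_iff)
    then have "[(int (i + a))\<^sup>2 = (int (j + a))\<^sup>2] (mod int p)"
      using coprime_p[of "c\<^sup>2"] c prime_dvd_power[OF prime_int, of c 2] cong_mult_lcancel by blast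
    then show "i = j"
      using half_residue_unique[of "i + a" "j + a"] ij by (simp add: N_def)
  qed
  define \<sigma> where "\<sigma> i = (if i < N then \<tau> i else i)" for i
  have "bij_betw \<tau> {0..<N} {0..<N}"
    using \<open>inj_on \<tau> {0..<N}\<close> \<tau>(1) by (simp add: bij_betw_def endo_inj_surj image_subset_iff)
  then have "bij_betw \<sigma> {0..<N} {0..<N}"
    by (subst bij_betw_cong[of _ _ \<tau>]) (auto simp: \<sigma>_def)
  then have perm: "\<sigma> permutes {0..<N}"
    by (rule bij_imp_permutes) (auto simp: \<sigma>_def)
  have \<sigma>: "[(int (\<sigma> i + a))\<^sup>2 = c\<^sup>2 * (int (i + a))\<^sup>2] (mod int p)" if "i < N" for i
    using \<tau>(2)[OF that] that by (simp add: \<sigma>_def)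
  define x where "x i = (int (i + a))\<^sup>2" for i
  have "[vandermonde N (x \<circ> \<sigma>) = vandermonde N (\<lambda>i. c\<^sup>2 * x i)] (mod int p)"
    unfolding vandermonde_def
    by (rule det_cong_mod, rule cong_pow) (simp add: x_def \<sigma>[unfolded of_nat_add])
  then have "[signof \<sigma> * vandermonde N x = (c\<^sup>2) ^ (N * (N - 1) div 2) * vandermonde N x] (mod int p)"
    by (simp add: vandermonde_permute[OF perm] vandermonde_scale)
  then have "[signof \<sigma> = (c\<^sup>2) ^ (N * (N - 1) div 2)] (mod int p)"
    using coprime_p[OF vandermonde_squares_coprime[of N a]] a
    by (simp add: cong_mult_rcancel x_def[abs_def] N_def)
  also have "(c\<^sup>2) ^ (N * (N - 1) div 2) = c ^ (N * (N - 1))"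
  proof -
    have "even (N * (N - 1))" by (cases N) auto
    then show ?thesis by (simp only: power_mult[symmetric] dvd_mult_div_cancel)
  qed
  \<comment> \<open>The product is \<open>(n + 1) * n\<close> for \<open>a = 0\<close> and
    \<open>n * (n - 1)\<close> for \<open>a = 1\<close>; the factor \<open>n\<close> makes Euler's
    criterion applicable.\<close>
  also have "N * (N - 1) = n * (n + 1 - 2 * a)"
    using a by (auto simp: N_def le_Suc_eq)
  also have "c ^ (n * (n + 1 - 2 * a)) = (c ^ n) ^ (n + 1 - 2 * a)"
    by (simp flip: power_mult)
  also have "[\<dots> = Legendre c (int p) ^ (n + 1 - 2 * a)] (mod int p)"
    by (intro cong_pow cong_sym[OF Legendre_cong_power])
  \<comment> \<open>The symbol is 1 or -1 and the two exponents have the same parity;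
    \<open>n_pos\<close> rules out truncated subtraction.\<close>
  also have "Legendre c (int p) ^ (n + 1 - 2 * a) = Legendre c (int p) ^ (n + 1)"
    using a c n_pos Legendre_values[of c "int p"] Legendre_eq_0_iff[of c "int p"]
    by (auto simp: minus_one_power_iff le_Suc_eq)
  finally have "signof \<sigma> = Legendre c (int p) ^ (n + 1)"
    by (rule cong_imp_eq_of_small[OF _ p_gt_2])
      (simp_all only: Legendre_power[symmetric] Legendre_values, simp add: sign_def)
  with perm \<sigma> that show ?thesis by blast
qed

section \<open>Legendre symbols of 2, of \<open>n!\<close> and of the binomial product\<close>

text \<open>The numbers \<open>j\<close> (\<open>j\<close> even) and \<open>p - j\<close> (\<open>j\<close> odd) with \<open>1 \<le> j \<le> n\<close> are exactly \<open>2, 4, \<dots>, 2n\<close>.\<close>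

lemma two_power_fact_cong:
  "[2 ^ n * fact n = (- 1) ^ (n * (n + 1) div 2) * fact n] (mod int p)"
proof -
  define f where "f j = (if even j then j else p - j)" for j
  have "(\<Prod>j\<in>{1..n}. int (f j)) = (\<Prod>k\<in>{1..n}. int (2 * k))"
    by (rule prod.reindex_bij_witness[of _ "\<lambda>k. if 2 * k \<le> n then 2 * k else p - 2 * k" "\<lambda>j. f j div 2"])
      (auto simp: f_def p_eq)
  also have "\<dots> = 2 ^ n * fact n"
    by (simp add: prod.distrib fact_prod)
  finally have *: "(\<Prod>j\<in>{1..n}. int (f j)) = 2 ^ n * fact n" .
  \<comment> \<open>Each odd \<open>j\<close> gives a sign because \<open>p - j \<equiv> -j\<close>;
    the total exponent is the sum of \<open>1, ..., n\<close>.\<close>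
  have "[(\<Prod>j\<in>{1..n}. int (f j)) = (\<Prod>j\<in>{1..n}. (- 1) ^ j * int j)] (mod int p)"
    by (rule cong_prod) (auto simp: f_def p_eq of_nat_diff cong_iff_dvd_diff)
  moreover have "(\<Prod>j\<in>{1..n}. (- 1 :: int) ^ j) = (- 1) ^ (n * (n + 1) div 2)"
    using gauss_sum_from_Suc_0[of n, where 'a = nat] by (simp flip: power_sum)
  then have "(\<Prod>j\<in>{1..n}. (- 1) ^ j * int j) = (- 1) ^ (n * (n + 1) div 2) * fact n"
    by (simp add: prod.distrib fact_prod)
  ultimately show ?thesis
    by (simp only: *)
qed

lemma Legendre_2: "Legendre 2 (int p) = (- 1) ^ (n * (n + 1) div 2)"
proof (rule Legendre_unique)
  show "[2 ^ n = (- 1) ^ (n * (n + 1) div 2)] (mod int p)"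
    using two_power_fact_cong cong_mult_rcancel[OF coprime_p[OF fact_coprime[OF order_refl]]] by blast
qed (simp add: minus_one_power_iff)

text \<open>Wilson's theorem: \<open>(p - 1)!\<close> is \<open>n!\<close> times the product of the
  \<open>p - k \<equiv> -k\<close> for \<open>k\<close> from 1 to \<open>n\<close>, and an even
  number of signs cancels.\<close>

lemma fact_square_cong:
  assumes "even n"
  shows "[(fact n)\<^sup>2 = - 1] (mod int p)"
proof -
  have "[(\<Prod>k\<in>{1..n}. int (p - k)) = (\<Prod>k\<in>{1..n}. - int k)] (mod int p)"
    by (rule cong_prod) (auto simp: p_eq of_nat_diff cong_iff_dvd_diff)
  also have "(\<Prod>k\<in>{1..n}. - int k) = fact n"
    using assms by (simp add: prod_uminus fact_prod)
  finally have "[fact n * (\<Prod>k\<in>{1..n}. int (p - k)) = (fact n)\<^sup>2] (mod int p)"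
    by (simp add: power2_eq_square cong_scalar_left)
  moreover have "fact n * (\<Prod>k\<in>{1..n}. int (p - k)) = fact (p - 1)"
  proof -
    have "(\<Prod>k\<in>{1..n}. int (p - k)) = (\<Prod>k\<in>{n+1..2*n}. int k)"
      by (rule prod.reindex_bij_witness[of _ "\<lambda>k. p - k" "\<lambda>k. p - k"]) (auto simp: p_eq)
    moreover have "{1..2*n} = {1..n} \<union> {n+1..2*n}" by auto
    ultimately show ?thesis
      by (simp add: p_eq fact_prod prod.union_disjoint)
  qed
  moreover have "[fact (p - 1) = - 1] (mod int p)"
    using wilson_theorem[OF prime] by simp
  ultimately show ?thesis
    by (metis cong_sym cong_trans)
qed

text \<open>If \<open>c\<^sup>2 = -1\<close> then \<open>2 c = (1 + c)\<^sup>2\<close>.\<close>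

lemma Legendre_sqrt_minus_1:
  assumes "[c\<^sup>2 = - 1] (mod int p)"
  shows "Legendre c (int p) = Legendre 2 (int p)"
proof -
  have "\<not> int p dvd 1 + c"
  proof
    assume "int p dvd 1 + c"
    then have "int p dvd (c\<^sup>2 + 1) - (1 + c) * (c - 1)"
      using assms by (intro dvd_diff dvd_mult2) (auto simp: cong_iff_dvd_diff)
    also have "(c\<^sup>2 + 1) - (1 + c) * (c - 1) = 2"
      by (simp add: power2_eq_square algebra_simps)
    finally show False
      using p_gt_2 zdvd_imp_le by force
  qed
  then have "Legendre ((1 + c)\<^sup>2) (int p) = 1"
    by (rule Legendre_square)
  moreover have "[(1 + c)\<^sup>2 = 2 * c] (mod int p)"
    using assms by (simp add: cong_iff_dvd_diff power2_eq_square algebra_simps)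
  ultimately have "Legendre 2 (int p) * Legendre c (int p) = 1"
    by (metis Legendre_cong Legendre_mult)
  then show ?thesis
    using Legendre_values[of c "int p"] Legendre_values[of 2 "int p"] by auto
qed

text \<open>Up to a square the product is \<open>n!\<close> to the power \<open>n + 1\<close>. For
  even \<open>n\<close> this exponent is odd and \<open>n!\<close> is a square root of -1 modulo
  \<open>p\<close>, giving the symbol of 2, while the sign factor has symbol 1. For odd
  \<open>n\<close> the two contributions swap roles.\<close>

lemma Legendre_prod_binomial:
  "Legendre ((- 1) ^ (n * (n + 1) div 2) * (\<Prod>k\<le>n. int (n choose k))) (int p) = Legendre 2 (int p)"
proof -
  let ?P = "\<Prod>k\<le>n. int (n choose k)"
  have "\<not> int p dvd (\<Prod>k\<le>n. fact k)"
    using fact_coprime prime_int by (simp add: prime_dvd_prod_iff)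
  then have "Legendre ((\<Prod>k\<le>n. fact k)\<^sup>2) (int p) = 1"
    by (rule Legendre_square)
  then have "Legendre ?P (int p) = Legendre (?P * (\<Prod>k\<le>n. fact k)\<^sup>2) (int p)"
    by (simp only: Legendre_mult mult_1_right)
  then have "Legendre ?P (int p) = Legendre (fact n) (int p) ^ (n + 1)"
    by (simp only: prod_binomial_fact Legendre_power)
  moreover have "Legendre (fact n) (int p) ^ (n + 1) = (if even n then Legendre 2 (int p) else 1)"
  proof (cases "even n")
    case True
    then have "Legendre (fact n) (int p) = Legendre 2 (int p)"
      by (intro Legendre_sqrt_minus_1 fact_square_cong)
    with True show ?thesis by (simp add: Legendre_2 minus_one_power_iff)
  next
    case False
    then show ?thesis
      using Legendre_values[of "fact n" "int p"] Legendre_eq_0_iff[of "fact n" "int p"] fact_coprime[of n]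
      by auto
  qed
  ultimately have "Legendre ?P (int p) = (if even n then Legendre 2 (int p) else 1)"
    by simp
  then show ?thesis
    unfolding Legendre_mult Legendre_power Legendre_minus_1 Legendre_2 by simp
qed

section \<open>The determinant \<open>T\<close> modulo \<open>p\<close>\<close>

lemma det_Legendre_cong:
  "[det (mat (n + 1) (n + 1) (\<lambda>(i, j). Legendre ((int i)\<^sup>2 + d * (int j)\<^sup>2 + c) (int p)))
    = (- 1) ^ (n * (n + 1) div 2) * (\<Prod>k\<le>n. int (n choose k)) * d ^ (n * (n + 1) div 2)
      * (vandermonde (n + 1) (\<lambda>i. (int i)\<^sup>2))\<^sup>2] (mod int p)"
proof -
  have "[det (mat (n + 1) (n + 1) (\<lambda>(i, j). Legendre ((int i)\<^sup>2 + d * (int j)\<^sup>2 + c) (int p)))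
    = det (mat (n + 1) (n + 1) (\<lambda>(i, j). (((int i)\<^sup>2 + c) + d * (int j)\<^sup>2) ^ n))] (mod int p)"
  proof (rule det_cong_mod)
    fix i j
    show "[Legendre ((int i)\<^sup>2 + d * (int j)\<^sup>2 + c) (int p) = (((int i)\<^sup>2 + c) + d * (int j)\<^sup>2) ^ n] (mod int p)"
      using Legendre_cong_power[of "(int i)\<^sup>2 + d * (int j)\<^sup>2 + c"] by (simp add: add_ac)
  qed
  \<comment> \<open>Shift invariance removes \<open>c\<close> from the points
    \<open>i^2 + c\<close>; scaling the points \<open>d * j^2\<close> extracts the power of
    \<open>d\<close>.\<close>
  then show ?thesis
    using det_power_sum[of n "\<lambda>i. (int i)\<^sup>2 + c" "\<lambda>j. d * (int j)\<^sup>2"]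
    by (simp add: vandermonde_shift vandermonde_scale power2_eq_square mult_ac)
qed

lemma half_p: "(p - 1) div 2 = n"
  by (simp add: p_eq)

lemma T_det_cong:
  "[T_det d p = (- 1) ^ (n * (n + 1) div 2) * (\<Prod>k\<le>n. int (n choose k)) * d ^ (n * (n + 1) div 2)
      * (vandermonde (n + 1) (\<lambda>i. (int i)\<^sup>2))\<^sup>2] (mod int p)"
  using det_Legendre_cong[of d 0] unfolding T_det_def half_p by (simp only: add_0_right)

lemma Legendre_T_det:
  assumes "\<not> int p dvd d"
  shows "Legendre (T_det d p) (int p) = Legendre 2 (int p) * Legendre d (int p) ^ (n * (n + 1) div 2)"
proof -
  have "\<not> int p dvd vandermonde (n + 1) (\<lambda>i. (int i)\<^sup>2)"
    using vandermonde_squares_coprime[of "n + 1" 0] by simp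
  then have "Legendre ((vandermonde (n + 1) (\<lambda>i. (int i)\<^sup>2))\<^sup>2) (int p) = 1"
    by (rule Legendre_square)
  then show ?thesis
    using Legendre_cong[OF T_det_cong, of d] Legendre_prod_binomial
    by (simp only: Legendre_mult Legendre_power mult_1_right)
qed

text \<open>The sign coming out of \<open>(- d) ^ m\<close> is \<open>(- 1) ^ m\<close>, which is
  the symbol of 2.\<close>

lemma T_det_minus_cong: "[T_det (- d) p = Legendre 2 (int p) * T_det d p] (mod int p)"
proof -
  define P where "P = (\<Prod>k\<le>n. int (n choose k))"
  define V where "V = (vandermonde (n + 1) (\<lambda>i. (int i)\<^sup>2))\<^sup>2"
  define m where "m = n * (n + 1) div 2"
  have "[Legendre 2 (int p) * T_det d p = (- 1) ^ m * ((- 1) ^ m * P * d ^ m * V)] (mod int p)"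
    using T_det_cong[of d] by (simp add: Legendre_2 P_def V_def m_def cong_scalar_left)
  also have "(- 1) ^ m * ((- 1) ^ m * P * d ^ m * V) = (- 1) ^ m * P * (- d) ^ m * V"
    by (simp add: power_minus[of d] mult_ac)
  finally show ?thesis
    using T_det_cong[of "- d"] by (simp add: P_def V_def m_def cong_def)
qed

section \<open>Exact identities, for \<open>S\<close> (\<open>a = 1\<close>) and \<open>T\<close>
  (\<open>a = 0\<close>) together\<close>

definition Legendre_det :: "nat \<Rightarrow> int \<Rightarrow> int" where
  "Legendre_det a d = det (mat (n + 1 - a) (n + 1 - a)
     (\<lambda>(i, j). Legendre ((int (i + a))\<^sup>2 + d * (int (j + a))\<^sup>2) (int p)))"

lemma S_det_eq: "S_det d p = Legendre_det 1 d"
  and T_det_eq: "T_det d p = Legendre_det 0 d"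
  unfolding S_det_def T_det_def Legendre_det_def half_p by (simp_all add: add.commute)

lemma Legendre_det_cong:
  assumes "[d = d'] (mod int p)"
  shows "Legendre_det a d = Legendre_det a d'"
proof -
  have "Legendre (x + d * y) (int p) = Legendre (x + d' * y) (int p)" for x y
    using assms by (intro Legendre_cong cong_add cong_mult cong_refl)
  then show ?thesis by (simp add: Legendre_det_def)
qed

lemma Legendre_det_square:
  assumes c: "\<not> int p dvd c" and a: "a \<le> 1"
  shows "Legendre_det a (c\<^sup>2 * d) = Legendre c (int p) ^ (n + 1) * Legendre_det a d"
proof -
  define N where "N = n + 1 - a"
  obtain \<sigma> where perm: "\<sigma> permutes {0..<N}"
    and \<sigma>: "\<And>i. i < N \<Longrightarrow> [(int (\<sigma> i + a))\<^sup>2 = c\<^sup>2 * (int (i + a))\<^sup>2] (mod int p)"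
    and sign: "signof \<sigma> = Legendre c (int p) ^ (n + 1)"
    using multiplication_permutation[OF assms] unfolding N_def by blast
  define f where "f = (\<lambda>(i, j). Legendre ((int (i + a))\<^sup>2 + d * (int (j + a))\<^sup>2) (int p))"
  \<comment> \<open>The factor \<open>c^2\<close> is absorbed into the column index through
    \<open>\<sigma>\<close>.\<close>
  have "Legendre ((int (i + a))\<^sup>2 + c\<^sup>2 * d * (int (j + a))\<^sup>2) (int p) = f (i, \<sigma> j)" if "j < N" for i j
    using cong_scalar_left[OF cong_sym[OF \<sigma>[OF that]], of d]
    unfolding f_def prod.case
    by (intro Legendre_cong cong_add cong_refl) (simp add: mult_ac)
  then have "Legendre_det a (c\<^sup>2 * d) = det (mat N N (\<lambda>(i, j). f (i, \<sigma> j)))"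
    unfolding Legendre_det_def N_def[symmetric] by (intro arg_cong[of _ _ det] eq_matI) auto
  also have "\<dots> = signof \<sigma> * det (mat N N f)"
    by (rule det_permute_columns[OF perm])
  finally show ?thesis
    unfolding sign by (simp only: Legendre_det_def f_def N_def)
qed

text \<open>For even \<open>n\<close> the number \<open>n!\<close> is a square root of -1 modulo
  \<open>p\<close>, so this is the square-factor case with \<open>c = n!\<close>, whose symbol is
  that of 2; the exponent \<open>n + 1\<close> is odd.\<close>

lemma Legendre_det_minus:
  assumes "even n" "a \<le> 1"
  shows "Legendre_det a (- d) = Legendre 2 (int p) * Legendre_det a d"
proof -
  have c: "[(fact n)\<^sup>2 = - 1] (mod int p)"
    by (rule fact_square_cong[OF assms(1)])
  have "[- d = (fact n)\<^sup>2 * d] (mod int p)"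
    using cong_scalar_right[OF cong_sym[OF c], of d] by simp
  then have "Legendre_det a (- d) = Legendre (fact n) (int p) ^ (n + 1) * Legendre_det a d"
    using Legendre_det_cong Legendre_det_square[OF fact_coprime[OF order_refl] assms(2)] by metis
  then show ?thesis
    using assms(1) Legendre_sqrt_minus_1[OF c] by (simp add: Legendre_2 minus_one_power_iff)
qed

text \<open>If \<open>d\<close> is a non-residue and so is \<open>-1\<close>, then \<open>d \<equiv> - c\<^sup>2\<close>, which reduces to \<open>d = -1\<close>, where the
  matrix is antisymmetric of odd size.\<close>

lemma S_det_eq_0:
  assumes n: "odd n" and d: "Legendre d (int p) = - 1"
  shows "S_det d p = 0"
proof -
  have "Legendre (- d) (int p) = 1"
    using Legendre_mult[of "- 1" d] n d by (simp add: Legendre_minus_1)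
  then obtain c where c: "[c\<^sup>2 = - d] (mod int p)"
    by (auto simp: Legendre_def QuadRes_def split: if_splits)
  then have d': "[d = c\<^sup>2 * (- 1)] (mod int p)"
    using cong_minus_minus_iff[of "c\<^sup>2" "- d"] by (simp add: cong_sym_eq)
  have "\<not> int p dvd c"
  proof
    assume "int p dvd c"
    then have "int p dvd c\<^sup>2 * (- 1)"
      by (simp add: power2_eq_square)
    then have "int p dvd d"
      by (simp only: cong_dvd_iff[OF d'])
    then show False using d Legendre_eq_0_iff[of d "int p"] by simp
  qed
  then have "S_det d p = Legendre c (int p) ^ (n + 1) * Legendre_det 1 (- 1)"
    unfolding S_det_eq Legendre_det_cong[OF d'] by (rule Legendre_det_square) simp
  moreover have "Legendre_det 1 (- 1) = 0"
  proof -
    define M where "M = mat n n (\<lambda>(i, j). Legendre ((int (i + 1))\<^sup>2 + (- 1) * (int (j + 1))\<^sup>2) (int p))"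
    have anti: "Legendre (x - y) (int p) = - Legendre (y - x) (int p)" for x y
      using Legendre_mult[of "- 1" "y - x"] n by (simp add: Legendre_minus_1)
    have "transpose_mat M = (- 1) \<cdot>\<^sub>m M"
      by (rule eq_matI) (auto simp: M_def intro: anti)
    then have "det M = (- 1) ^ n * det M"
      using det_transpose[of M n] det_smult[of "- 1" M] by (simp add: M_def)
    then show ?thesis
      using n by (simp add: M_def Legendre_det_def)
  qed
  ultimately show ?thesis by simp
qed

end

theorem theorem1p2:
  fixes p :: nat
  assumes "prime p" and "odd p"
  shows
    "(\<forall>d c :: int. \<not> int p dvd c \<longrightarrow>
        S_det (c\<^sup>2 * d) p = Legendre c (int p) ^ ((p + 1) div 2) * S_det d p \<and>
        T_det (c\<^sup>2 * d) p = Legendre c (int p) ^ ((p + 1) div 2) * T_det d p)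
   \<and> (p mod 4 = 1 \<longrightarrow> (\<forall>d :: int.
        S_det (- d) p = Legendre 2 (int p) * S_det d p \<and>
        T_det (- d) p = Legendre 2 (int p) * T_det d p))
   \<and> (p mod 4 = 3 \<longrightarrow> (\<forall>d :: int. Legendre d (int p) = - 1 \<longrightarrow> S_det d p = 0))
   \<and> (\<forall>d :: int.
        (Legendre d (int p) = 1 \<longrightarrow> Legendre (T_det d p) (int p) = Legendre 2 (int p)) \<and>
        (Legendre d (int p) = - 1 \<longrightarrow> Legendre (T_det d p) (int p) = 1))
   \<and> (\<forall>d :: int. [T_det (- d) p = Legendre 2 (int p) * T_det d p] (mod (int p)))
   \<and> (\<forall>c d :: int.
        [det (mat ((p - 1) div 2 + 1) ((p - 1) div 2 + 1)
           (\<lambda>(i, j). Legendre ((int i)\<^sup>2 + d * (int j)\<^sup>2 + c) (int p)))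
         = T_det d p] (mod (int p)))"
proof -
  define n where "n = (p - 1) div 2"
  have p: "p = 2 * n + 1"
    using assms(2) by (auto simp: n_def elim: oddE)
  interpret odd_prime p n
    using assms(1) p by unfold_locales
  have half: "(p + 1) div 2 = n + 1"
    by (simp add: p)
  have parity: "p mod 4 = 1 \<longrightarrow> even n" "p mod 4 = 3 \<longrightarrow> odd n"
    using p by presburger+
  have "Legendre (T_det d p) (int p) = Legendre 2 (int p)" if "Legendre d (int p) = 1" for d
    using Legendre_T_det[of d] that Legendre_eq_0_iff[of d "int p"] by simp
  \<comment> \<open>Here the power of the symbol of \<open>d\<close> is again the symbol of 2, and
    the two signs cancel.\<close>
  moreover have "Legendre (T_det d p) (int p) = 1" if "Legendre d (int p) = - 1" for d
    using Legendre_T_det[of d] that Legendre_eq_0_iff[of d "int p"]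
    by (simp add: Legendre_2 flip: power_mult_distrib)
  \<comment> \<open>The value in \<open>det_Legendre_cong\<close> is independent of
    \<open>c\<close>.\<close>
  moreover have "[det (mat (n + 1) (n + 1) (\<lambda>(i, j). Legendre ((int i)\<^sup>2 + d * (int j)\<^sup>2 + c) (int p)))
      = T_det d p] (mod int p)" for c d
    using det_Legendre_cong T_det_cong cong_sym cong_trans by blast
  ultimately show ?thesis
    unfolding half half_p
    using Legendre_det_square Legendre_det_minus S_det_eq_0 T_det_minus_cong parity
    by (simp add: S_det_eq T_det_eq)
qed

end
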